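(* Let $V_0,V_1,V_2$ be Hilbert spaces forming an exact sequence $$\ker(\mathrm d_0)\xrightarrow{\subset}V_0\xrightarrow{\mathrm d_0}V_1\xrightarrow{\mathrm d_1}V_2\to0 .$$ Let $\mathrm d_2$ be a linear operator on $V_0$ and $s^*$ a linear operator on $V_1$ (with a common target space) such that $s^*\mathrm d_0=\mathrm d_2$. Let $W$ be a closed subspace contained in $s^*(V_1)$, and define $$\widehat V_0=\{u\in V_0:\mathrm d_2u\in W\},\qquad \widehat V_1=\{v\in V_1:s^*v\in W\}.$$ Assume $\ker(\mathrm d_0)\subset\widehat V_0$ and $\mathrm d_1(\widehat V_1)=V_2$. Then $$\ker(\mathrm d_0)\xrightarrow{\subset}\widehat V_0\xrightarrow{\mathrm d_0}\widehat V_1\xrightarrow{\mathrm d_1}V_2\to0$$ is also an exact sequence.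
   Context: Exactness of $\ker(\mathrm d_0)\to V_0\to V_1\to V_2\to0$ means $\ker(\mathrm d_1)=\mathrm d_0(V_0)$ and $\mathrm d_1(V_1)=V_2$, where $\mathrm d_0:V_0\to V_1$, $\mathrm d_1:V_1\to V_2$ are linear. *)

theory Defs
  imports "HOL-Analysis.Inner_Product"
begin

text \<open>
  The sequence \<open>K \<rightarrow> A \<rightarrow> B \<rightarrow> C \<rightarrow> 0\<close> of linear subspaces, whose first arrow is the inclusion
  and whose next two arrows are the restrictions of \<open>d0\<close> and \<open>d1\<close>, is well defined and exact.
  The last four conjuncts say, in turn, that \<open>d0\<close> maps \<open>A\<close> into \<open>B\<close>, and that the sequence is
  exact at \<open>A\<close>, at \<open>B\<close> and at \<open>C\<close>; exactness at \<open>A\<close> contains the inclusion of \<open>K\<close> in \<open>A\<close>.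
\<close>

definition exact_sequence ::
  "'a::real_vector set \<Rightarrow> 'a set \<Rightarrow> ('a \<Rightarrow> 'b::real_vector) \<Rightarrow> 'b set
    \<Rightarrow> ('b \<Rightarrow> 'c::real_vector) \<Rightarrow> 'c set \<Rightarrow> bool"
  where "exact_sequence K A d0 B d1 C \<longleftrightarrow>
    linear d0 \<and> linear d1 \<and> subspace A \<and> subspace B \<and> subspace C \<and>
    d0 ` A \<subseteq> B \<and>
    {u \<in> A. d0 u = 0} = K \<and>
    {v \<in> B. d1 v = 0} = d0 ` A \<and>
    d1 ` B = C"

end

theory Submission
  imports Defs
begin

text \<open>
  Since \<open>s \<circ> d0 = d2\<close>, the subspace \<open>Vh0\<close> is the full preimage of \<open>Vh1\<close> under \<open>d0\<close>. Hence
  \<open>d0 ` Vh0 = Vh1 \<inter> range d0\<close>, which is the kernel of \<open>d1\<close> on \<open>Vh1\<close> by exactness of the original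
  sequence. Exactness at the two ends is contained in the hypotheses \<open>ker\<close> and \<open>onto\<close>.
\<close>

theorem lemma2p1:
  fixes d0 :: "'v0::{real_inner, complete_space} \<Rightarrow> 'v1::{real_inner, complete_space}"
    and d1 :: "'v1 \<Rightarrow> 'v2::{real_inner, complete_space}"
    and d2 :: "'v0 \<Rightarrow> 'x::{real_vector, topological_space}"
    and s :: "'v1 \<Rightarrow> 'x"
    and W :: "'x set"
    and Vh0 :: "'v0 set"
    and Vh1 :: "'v1 set"
  assumes exact: "exact_sequence {u. d0 u = 0} UNIV d0 UNIV d1 UNIV"
    and d2: "linear d2"
    and s: "linear s"
    and s_d0: "s \<circ> d0 = d2"
    and W: "subspace W" "closed W" "W \<subseteq> range s"
    and Vh0: "Vh0 = {u. d2 u \<in> W}"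
    and Vh1: "Vh1 = {v. s v \<in> W}"
    and ker: "{u. d0 u = 0} \<subseteq> Vh0"
    and onto: "d1 ` Vh1 = UNIV"
  shows "exact_sequence {u. d0 u = 0} Vh0 d0 Vh1 d1 UNIV"
proof -
  have d0: "linear d0" and d1: "linear d1" and ker_d1: "{v. d1 v = 0} = range d0"
    using exact by (auto simp: exact_sequence_def)
  have "subspace Vh0"
    using linear_subspace_vimage[OF d2 W(1)] by (simp add: Vh0 vimage_def)
  moreover have "subspace Vh1"
    using linear_subspace_vimage[OF s W(1)] by (simp add: Vh1 vimage_def)
  moreover have preimage: "u \<in> Vh0 \<longleftrightarrow> d0 u \<in> Vh1" for u
    using s_d0 by (auto simp: Vh0 Vh1)
  moreover have "{u \<in> Vh0. d0 u = 0} = {u. d0 u = 0}"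
    using ker by auto
  moreover have "{v \<in> Vh1. d1 v = 0} = d0 ` Vh0"
  proof -
    have "{v \<in> Vh1. d1 v = 0} = Vh1 \<inter> range d0"
      using ker_d1 by auto
    also have "\<dots> = d0 ` Vh0"
      using preimage by auto
    finally show ?thesis .
  qed
  ultimately show ?thesis
    using d0 d1 onto by (auto simp: exact_sequence_def)
qed

end
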